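(* Let $n$ be a positive integer and let $D(n,\mathbb{R})$ be the set of real $n\times n$ matrices that are diagonalizable over $\mathbb{R}$. Then the maximal dimension of a linear subspace of $M(n\times n,\mathbb{R})$ contained in $D(n,\mathbb{R})$ is $\frac{n(n+1)}{2}$, while the maximal dimension of an affine subspace of $M(n\times n,\mathbb{R})$ that is contained in $D(n,\mathbb{R})$ and is not a linear subspace is $\frac{n(n+1)}{2}-1$.
   Context: $M(n\times n,\mathbb{R})$ denotes the real vector space of $n\times n$ real matrices. An affine subspace is a set $S=P+Z$ with $P\in M(n\times n,\mathbb{R})$ and $Z$ an $\mathbb{R}$-linear subspace of $M(n\times n,\mathbb{R})$; its dimension is $\dim_{\mathbb{R}} Z$. It is "affine not linear" if it is not a linear subspace, i.e. $P\notin Z$ (equivalently $0\notin S$). "The maximal dimension is $d$" means that every such subspace has dimension at most $d$ and some such subspace has dimension exactly $d$. *)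

theory Defs
  imports "HOL-Analysis.Analysis"
begin

definition diagonal_matrix :: "real^'n::finite^'n \<Rightarrow> bool" where
  "diagonal_matrix A \<longleftrightarrow> (\<forall>i j. i \<noteq> j \<longrightarrow> A $ i $ j = 0)"

definition diagonalizable :: "real^'n::finite^'n \<Rightarrow> bool" where
  "diagonalizable A \<longleftrightarrow>
     (\<exists>(Q :: real^'n^'n) D. invertible Q \<and> diagonal_matrix D \<and> A = Q ** D ** matrix_inv Q)"

definition diagonalizable_matrices :: "(real^'n::finite^'n) set" where
  "diagonalizable_matrices = {A. diagonalizable A}"

text \<open>The library predicate \<^const>\<open>affine\<close> also holds of the empty set; the
  affine subspaces here are nonempty translates \<open>P + Z\<close> of a linear subspace.
  Since \<open>Z\<close> is determined by \<open>S\<close> (it is the set of differences), so is the dimension.\<close>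

definition affine_subspace_of_dim :: "nat \<Rightarrow> (real^'n::finite^'n) set \<Rightarrow> bool" where
  "affine_subspace_of_dim d S \<longleftrightarrow> (\<exists>P Z. subspace Z \<and> S = (+) P ` Z \<and> dim Z = d)"

lemma affine_subspace_of_dim_iff:
  "affine_subspace_of_dim d S \<longleftrightarrow> affine S \<and> S \<noteq> {} \<and> aff_dim S = int d"
proof
  assume "affine_subspace_of_dim d S"
  then obtain P Z where Z: "subspace Z" "S = (+) P ` Z" "dim Z = d"
    unfolding affine_subspace_of_dim_def by blast
  have "affine Z" "Z \<noteq> {}"
    using Z(1) subspace_0 by (auto intro: subspace_imp_affine)
  with Z show "affine S \<and> S \<noteq> {} \<and> aff_dim S = int d"
    by (auto simp: affine_translation [symmetric] aff_dim_translation_eq aff_dim_subspace)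
next
  assume S: "affine S \<and> S \<noteq> {} \<and> aff_dim S = int d"
  then obtain P where P: "P \<in> S" by blast
  let ?Z = "(+) (- P) ` S"
  have sub: "subspace ?Z"
    using S P affine_diffs_subspace by blast
  have "int (dim ?Z) = int d"
    using S aff_dim_subspace [OF sub] aff_dim_translation_eq [of "- P" S] by metis
  moreover have "S = (+) P ` ?Z"
    by (simp add: image_image)
  ultimately show "affine_subspace_of_dim d S"
    unfolding affine_subspace_of_dim_def using sub by (metis of_nat_eq_iff)
qed

end

theory Submission
  imports Defs
begin

text \<open>For diagonalizable \<open>A\<close> the number \<open>tr (A\<^sup>2)\<close> is a sum of squares, while
  \<open>tr (A\<^sup>2) = - \<bar>A\<bar>\<^sup>2\<close> for skew-symmetric \<open>A\<close>. If \<open>P + Z\<close> consists of diagonalizable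
  matrices, then \<open>tr (A\<^sup>2) \<ge> 0\<close> persists on all of \<open>span (P, Z)\<close>, by scaling and by letting
  \<open>t\<close> tend to infinity in \<open>P + t z\<close>. So this span meets the skew-symmetric matrices only in \<open>0\<close>
  and has dimension at most \<open>n\<^sup>2 - n (n - 1) / 2\<close>. Equality is attained, by the spectral theorem,
  by the symmetric matrices and by a hyperplane in them that avoids \<open>0\<close>.\<close>

section \<open>The trace form\<close>

lemma matrix_inv_inverse:
  fixes Q :: "real^'n::finite^'n"
  assumes "invertible Q"
  shows "Q ** matrix_inv Q = mat 1" "matrix_inv Q ** Q = mat 1"
  using someI_ex [OF assms [unfolded invertible_def]] by (simp_all add: matrix_inv_def)

text \<open>Conjugation by \<open>Q\<close> does not change the trace, so only the squares of the
  diagonal entries of \<open>D\<close> remain.\<close>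

lemma trace_square_diagonalizable_nonneg:
  fixes A :: "real^'n::finite^'n"
  assumes "diagonalizable A"
  shows "0 \<le> trace (A ** A)"
proof -
  obtain Q D :: "real^'n^'n"
    where Q: "invertible Q" and D: "diagonal_matrix D" and A: "A = Q ** D ** matrix_inv Q"
    using assms unfolding diagonalizable_def by blast
  have inv: "matrix_inv Q ** Q = mat 1"
    using Q by (simp add: matrix_inv_inverse)
  have "A ** A = Q ** D ** (matrix_inv Q ** Q) ** D ** matrix_inv Q"
    by (simp add: A matrix_mul_assoc)
  also have "\<dots> = Q ** (D ** D ** matrix_inv Q)"
    by (simp add: inv matrix_mul_assoc)
  finally have "trace (A ** A) = trace (D ** D ** matrix_inv Q ** Q)"
    by (metis trace_mul_sym)
  also have "\<dots> = trace (D ** D)"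
    by (simp add: inv flip: matrix_mul_assoc)
  also have "\<dots> = (\<Sum>i\<in>UNIV. (D $ i $ i)\<^sup>2)"
  proof -
    have "(\<Sum>k\<in>UNIV. D $ i $ k * D $ k $ i) = (\<Sum>k\<in>UNIV. if k = i then (D $ i $ i)\<^sup>2 else 0)" for i
      using D by (intro sum.cong) (auto simp: diagonal_matrix_def power2_eq_square)
    then show ?thesis
      by (simp add: trace_def matrix_matrix_mult_def)
  qed
  also have "\<dots> \<ge> 0"
    by (simp add: sum_nonneg)
  finally show ?thesis .
qed

lemma trace_square_skew:
  fixes A :: "real^'n::finite^'n"
  assumes "transpose A = - A"
  shows "trace (A ** A) = - (A \<bullet> A)"
proof -
  have "A $ i $ j * A $ j $ i = - (A $ i $ j * A $ i $ j)" for i j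
    using arg_cong [OF assms, of "\<lambda>B. B $ i $ j"] by (simp add: transpose_def)
  then show ?thesis
    by (simp add: trace_def matrix_matrix_mult_def inner_vec_def sum_negf [symmetric])
qed

lemma trace_square_scaleR:
  fixes A :: "real^'n::finite^'n"
  shows "trace ((c *\<^sub>R A) ** (c *\<^sub>R A)) = c\<^sup>2 * trace (A ** A)"
  by (simp add: trace_def matrix_matrix_mult_def sum_distrib_left power2_eq_square mult_ac)

text \<open>Adding the values at \<open>A + B\<close> and \<open>A - B\<close> cancels the cross
  terms, so no bilinear form has to be introduced.\<close>

lemma trace_square_parallelogram:
  fixes A B :: "real^'n::finite^'n"
  shows "trace ((A + B) ** (A + B)) + trace ((A - B) ** (A - B)) =
    2 * trace (A ** A) + 2 * trace (B ** B)"
  by (simp add: trace_def matrix_matrix_mult_def sum.distrib [symmetric] sum_distrib_left algebra_simps)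

text \<open>Along the line the trace is a quadratic polynomial in \<open>t\<close> with leading
  coefficient \<open>trace (z ** z)\<close>; a negative one would win for large
  \<open>t\<close>.\<close>

lemma trace_square_direction_nonneg:
  fixes P z :: "real^'n::finite^'n"
  assumes "\<And>t. 0 \<le> trace ((P + t *\<^sub>R z) ** (P + t *\<^sub>R z))"
  shows "0 \<le> trace (z ** z)"
proof (rule ccontr)
  assume "\<not> ?thesis"
  then have neg: "trace (z ** z) < 0" by simp
  \<comment> \<open>Averaging the hypothesis over \<open>t\<close> and \<open>- t\<close> removes
    the term linear in \<open>t\<close>.\<close>
  have bound: "0 \<le> trace (P ** P) + t\<^sup>2 * trace (z ** z)" for t
    using assms [of t] assms [of "- t"] trace_square_parallelogram [of P "t *\<^sub>R z"]
    by (simp add: trace_square_scaleR)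
  have "0 \<le> trace (P ** P)"
    using bound [of 0] by simp
  \<comment> \<open>This \<open>t\<close> is chosen so that the right-hand side of
    \<open>bound\<close> equals -1.\<close>
  then have "(sqrt ((trace (P ** P) + 1) / - trace (z ** z)))\<^sup>2 = (trace (P ** P) + 1) / - trace (z ** z)"
    using neg by (intro real_sqrt_pow2 divide_nonneg_pos) auto
  then show False
    using bound [of "sqrt ((trace (P ** P) + 1) / - trace (z ** z))"] neg
    by (simp add: field_simps)
qed

section \<open>Symmetric and skew-symmetric matrices\<close>

definition symmetric_matrices :: "(real^'n::finite^'n) set" where
  "symmetric_matrices = {A. transpose A = A}"

definition skew_matrices :: "(real^'n::finite^'n) set" where
  "skew_matrices = {A. transpose A = - A}"

lemma linear_transpose: "linear (transpose :: real^'n^'m \<Rightarrow> real^'m^'n)"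
  by (rule linearI) (simp_all add: transpose_def vec_eq_iff)

lemma subspace_symmetric_matrices: "subspace symmetric_matrices"
  by (auto simp: subspace_def symmetric_matrices_def linear_add [OF linear_transpose]
      linear_cmul [OF linear_transpose] linear_0 [OF linear_transpose])

lemma subspace_skew_matrices: "subspace skew_matrices"
  by (auto simp: subspace_def skew_matrices_def linear_add [OF linear_transpose]
      linear_cmul [OF linear_transpose] linear_0 [OF linear_transpose])

lemma dim_add_le_DIM:
  fixes S T :: "'a::euclidean_space set"
  assumes "subspace S" "subspace T" "S \<inter> T \<subseteq> {0}"
  shows "dim S + dim T \<le> DIM('a)"
proof -
  have "S \<inter> T = {0}"
    using assms by (auto simp: subspace_0)
  then show ?thesis
    using dim_sums_Int [OF assms(1,2)] dim_subset_UNIV [of "{x + y |x y. x \<in> S \<and> y \<in> T}"] by simp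
qed

text \<open>Nonzero pairwise orthogonal vectors are independent. Orthogonality also makes
  \<open>f\<close> injective, so the index set itself can be counted.\<close>

lemma card_le_dim_orthogonal:
  fixes f :: "'i \<Rightarrow> 'a::euclidean_space"
  assumes "\<And>i. i \<in> I \<Longrightarrow> f i \<in> V" "\<And>i. i \<in> I \<Longrightarrow> f i \<noteq> 0"
    and orth: "\<And>i j. i \<in> I \<Longrightarrow> j \<in> I \<Longrightarrow> i \<noteq> j \<Longrightarrow> f i \<bullet> f j = 0"
  shows "card I \<le> dim V"
proof -
  have "inj_on f I"
    using assms by (metis inj_onI inner_eq_zero_iff)
  moreover have "independent (f ` I)"
    using assms by (intro pairwise_orthogonal_independent) (auto simp: pairwise_def orthogonal_def)
  ultimately show ?thesis
    using assms(1) independent_card_le_dim [of "f ` I" V] by (simp add: card_image image_subset_iff)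
qed

text \<open>The index type carries no order, so \<open>e\<close> supplies one. The square splits
  into the pairs below the diagonal, their mirror images and the diagonal.\<close>

lemma card_pairs:
  fixes e :: "'n::finite \<Rightarrow> nat"
  assumes "inj e"
  shows "2 * card {p. e (fst p) < e (snd p)} + CARD('n) = CARD('n)\<^sup>2" (is "2 * card ?L + _ = _")
    and "card {p. e (fst p) \<le> e (snd p)} = card {p. e (fst p) < e (snd p)} + CARD('n)"
      (is "card ?K = _")
proof -
  let ?D = "(\<lambda>i. (i, i)) ` (UNIV :: 'n set)"
  have D: "card ?D = CARD('n)"
    by (simp add: card_image inj_on_def)
  have K: "?K = ?L \<union> ?D"
    using assms by (auto simp: le_less inj_eq)
  have "card (?L \<union> ?D) = card ?L + card ?D"
    by (intro card_Un_disjoint) auto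
  with K D show card_K: "card ?K = card ?L + CARD('n)" by simp
  have swap: "card (prod.swap ` ?L) = card ?L"
    by (simp add: card_image)
  have "UNIV = ?K \<union> prod.swap ` ?L"
    by (auto simp: image_iff)
  moreover have "card (?K \<union> prod.swap ` ?L) = card ?K + card (prod.swap ` ?L)"
    by (intro card_Un_disjoint) auto
  ultimately have "CARD('n \<times> 'n) = card ?K + card ?L"
    using swap by simp
  with card_K show "2 * card ?L + CARD('n) = CARD('n)\<^sup>2"
    by (simp add: power2_eq_square)
qed

lemma transpose_axis: "transpose (axis i (axis j x)) = (axis j (axis i x) :: real^'n::finite^'n)"
  by (auto simp: transpose_def axis_def vec_eq_iff)

text \<open>Explicit orthogonal families give only lower bounds for both dimensions. These add up to
  the dimension of the whole space, and the two subspaces meet in 0, so both bounds are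
  sharp.\<close>

lemma dim_symmetric_skew:
  fixes n :: nat
  assumes n: "n = CARD('n::finite)"
  shows "2 * dim (symmetric_matrices :: (real^'n^'n) set) = n * (n + 1)"
    and "2 * dim (skew_matrices :: (real^'n^'n) set) + n = n\<^sup>2"
proof -
  obtain e :: "'n \<Rightarrow> nat" where e: "inj e"
    using finite_imp_inj_to_nat_seg [of "UNIV :: 'n set"] by auto
  note e_eq = inj_eq [OF e]
  let ?L = "{p. e (fst p) < e (snd p)}" and ?K = "{p. e (fst p) \<le> e (snd p)}"
  let ?E = "\<lambda>i j. axis i (axis j 1) :: real^'n^'n"
  \<comment> \<open>On the diagonal \<open>?s\<close> is twice a matrix unit while \<open>?a\<close>
    vanishes; hence \<open>?K\<close> indexes the first family and \<open>?L\<close> the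
    second.\<close>
  let ?s = "\<lambda>p. ?E (fst p) (snd p) + ?E (snd p) (fst p)"
    and ?a = "\<lambda>p. ?E (fst p) (snd p) - ?E (snd p) (fst p)"
  have E: "?E i j \<bullet> ?E k l = (if i = k \<and> j = l then 1 else 0)" for i j k l
    by (simp add: inner_axis_axis)
  have s0: "?s p \<noteq> 0" for p
  proof -
    have "?s p \<bullet> ?E (fst p) (snd p) \<ge> 1"
      by (simp only: inner_add_left E) simp
    then show ?thesis by fastforce
  qed
  have a0: "?a p \<noteq> 0" if "p \<in> ?L" for p
  proof -
    have "fst p \<noteq> snd p"
      using that by auto
    then have "?a p \<bullet> ?E (fst p) (snd p) = 1"
      by (simp only: inner_diff_left E) simp
    then show ?thesis by fastforce
  qed
  have so: "?s p \<bullet> ?s q = 0" if "p \<in> ?K" "q \<in> ?K" "p \<noteq> q" for p q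
  proof -
    \<comment> \<open>Mirrored pairs give the same matrix \<open>?s\<close>. Two of them in
      \<open>?K\<close> would have equal \<open>e\<close>-values, hence lie on the diagonal and
      coincide.\<close>
    have "p \<noteq> prod.swap q"
      using that e_eq by (cases p; cases q) auto
    with that(3) show ?thesis
      by (cases p; cases q) (auto simp only: inner_add_left inner_add_right E fst_conv snd_conv swap_simp
        prod.inject if_False add_0 split: if_split)
  qed
  have ao: "?a p \<bullet> ?a q = 0" if "p \<in> ?L" "q \<in> ?L" "p \<noteq> q" for p q
  proof -
    have "p \<noteq> prod.swap q"
      using that by (cases p; cases q) auto
    with that(3) show ?thesis
      by (cases p; cases q) (auto simp only: inner_diff_left inner_diff_right E fst_conv snd_conv swap_simp
        prod.inject if_False diff_0_right split: if_split)
  qed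
  have sV: "?s p \<in> symmetric_matrices" and aV: "?a p \<in> skew_matrices" for p
    by (simp_all add: symmetric_matrices_def skew_matrices_def transpose_axis add.commute
      linear_add [OF linear_transpose] linear_diff [OF linear_transpose])
  have K: "card ?K \<le> dim (symmetric_matrices :: (real^'n^'n) set)"
    using sV s0 so by (rule card_le_dim_orthogonal)
  have L: "card ?L \<le> dim (skew_matrices :: (real^'n^'n) set)"
    using aV a0 ao by (rule card_le_dim_orthogonal)
  have "A = 0" if "A \<in> symmetric_matrices" "A \<in> skew_matrices" for A :: "real^'n^'n"
  proof -
    have "A = - A"
      using that by (simp add: symmetric_matrices_def skew_matrices_def)
    then show ?thesis
      by (simp add: vec_eq_iff eq_neg_iff_add_eq_0)
  qed
  then have "symmetric_matrices \<inter> skew_matrices \<subseteq> {0 :: real^'n^'n}"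
    by blast
  with dim_add_le_DIM [OF subspace_symmetric_matrices subspace_skew_matrices]
  have U: "dim (symmetric_matrices :: (real^'n^'n) set) + dim (skew_matrices :: (real^'n^'n) set) \<le> n\<^sup>2"
    by (fastforce simp: n power2_eq_square)
  note c = card_pairs [OF e, folded n]
  \<comment> \<open>By \<open>c\<close> the cardinalities of \<open>?K\<close> and \<open>?L\<close>
    sum to \<open>n\<^sup>2\<close>, so \<open>K\<close>, \<open>L\<close> and \<open>U\<close>
    become equalities.\<close>
  show "2 * dim (symmetric_matrices :: (real^'n^'n) set) = n * (n + 1)"
    using K L U c by (simp add: power2_eq_square)
  show "2 * dim (skew_matrices :: (real^'n^'n) set) + n = n\<^sup>2"
    using K L U c by (simp add: power2_eq_square)
qed

text \<open>The upper bound behind both the linear and the affine case: a nonnegative trace form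
  leaves only 0 in common with the skew matrices, whose codimension is the dimension of the
  symmetric ones.\<close>

lemma dim_le_symmetric:
  fixes W :: "(real^'n::finite^'n) set"
  assumes "subspace W" "\<And>A. A \<in> W \<Longrightarrow> 0 \<le> trace (A ** A)"
  shows "dim W \<le> dim (symmetric_matrices :: (real^'n^'n) set)"
proof -
  have "A = 0" if "A \<in> W" "A \<in> skew_matrices" for A
  proof -
    have "A \<bullet> A \<le> 0"
      using assms(2) [OF that(1)] trace_square_skew [of A] that(2) by (simp add: skew_matrices_def)
    then show ?thesis
      by (metis inner_gt_zero_iff not_le)
  qed
  then have "W \<inter> skew_matrices \<subseteq> {0}"
    by blast
  then have "dim W + dim (skew_matrices :: (real^'n^'n) set) \<le> CARD('n)\<^sup>2"
    using dim_add_le_DIM [OF assms(1) subspace_skew_matrices] by (simp add: power2_eq_square)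
  then show ?thesis
    using dim_symmetric_skew [OF refl, where 'n = 'n] by (simp add: power2_eq_square)
qed

section \<open>The spectral theorem\<close>

text \<open>A maximizer of the Rayleigh quotient on the unit sphere of \<open>S\<close> is an eigenvector.\<close>

lemma self_adjoint_eigenvector:
  fixes f :: "'a::euclidean_space \<Rightarrow> 'a"
  assumes f: "linear f" and sa: "\<And>x y. f x \<bullet> y = x \<bullet> f y"
    and S: "subspace S" and inv: "\<And>x. x \<in> S \<Longrightarrow> f x \<in> S" and "S \<noteq> {0}"
  obtains v c where "v \<in> S" "norm v = 1" "f v = c *\<^sub>R v"
proof -
  obtain u where u: "u \<in> S" "u \<noteq> 0"
    using S \<open>S \<noteq> {0}\<close> subspace_0 by blast
  let ?K = "sphere 0 1 \<inter> S"
  have "compact ?K"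
    by (intro compact_Int_closed closed_subspace S) auto
  moreover have "(1 / norm u) *\<^sub>R u \<in> ?K"
    using u S by (auto intro: subspace_scale)
  moreover have "continuous_on ?K (\<lambda>x. x \<bullet> f x)"
    by (intro continuous_intros linear_continuous_on linear_conv_bounded_linear [THEN iffD1] f)
  ultimately obtain v where v: "v \<in> ?K" and max: "\<And>x. x \<in> ?K \<Longrightarrow> x \<bullet> f x \<le> v \<bullet> f v"
    using continuous_attains_sup [of ?K "\<lambda>x. x \<bullet> f x"] by blast
  define c where "c = v \<bullet> f v"
  have vS: "v \<in> S" and vn: "norm v = 1" and vv: "v \<bullet> v = 1"
    using v by (auto simp: norm_eq_1)
  \<comment> \<open>Homogeneity carries maximality from the unit sphere to all of
    \<open>S\<close>.\<close>
  have quad: "x \<bullet> f x \<le> c * (x \<bullet> x)" if "x \<in> S" for x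
  proof (cases "x = 0")
    case False
    have "(1 / norm x) *\<^sub>R x \<in> ?K"
      using False that S by (auto intro: subspace_scale)
    from max [OF this] have "(x \<bullet> f x) / (norm x)\<^sup>2 \<le> c"
      by (simp add: linear_cmul [OF f] c_def power2_eq_square)
    then show ?thesis
      using False by (simp add: field_simps power2_norm_eq_inner)
  qed simp
  \<comment> \<open>The residual of the eigenvalue equation, orthogonal to \<open>v\<close>; it
    remains to show that it vanishes.\<close>
  define w where "w = f v - c *\<^sub>R v"
  have wS: "w \<in> S"
    unfolding w_def by (intro subspace_diff S subspace_scale inv vS)
  have wv: "w \<bullet> v = 0"
    by (simp add: w_def inner_diff_left vv c_def inner_commute [of "f v"])
  have wfv: "w \<bullet> f v = w \<bullet> w"
    using wv by (simp add: w_def inner_diff_right)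
  define b where "b = c * (w \<bullet> w) - w \<bullet> f w"
  \<comment> \<open>Perturbing the maximizer to \<open>v + t *\<^sub>R w\<close>: the first-order
    gain cannot exceed the second-order loss.\<close>
  have ineq: "2 * t * (w \<bullet> w) \<le> t\<^sup>2 * b" for t
  proof -
    have "v + t *\<^sub>R w \<in> S"
      by (intro subspace_add S subspace_scale vS wS)
    from quad [OF this] show ?thesis
      using sa [of v w] wv
      by (simp add: linear_add [OF f] linear_cmul [OF f] inner_add_left inner_add_right vv wfv b_def
          inner_commute [of v w] inner_commute [of "f v" w] c_def [symmetric] power2_eq_square algebra_simps)
  qed
  have b: "0 \<le> b"
    using quad [OF wS] by (simp add: b_def)
  have "w \<bullet> w = 0"
  proof (rule ccontr)
    assume "w \<bullet> w \<noteq> 0"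
    then have "0 < w \<bullet> w" by simp
    \<comment> \<open>Small enough for \<open>t * b \<le> w \<bullet> w\<close>; the added 1 keeps
      the denominator positive when \<open>b\<close> is 0.\<close>
    define t where "t = (w \<bullet> w) / (b + 1)"
    have "t > 0"
      using \<open>0 < w \<bullet> w\<close> b by (simp add: t_def)
    then have "2 * (w \<bullet> w) \<le> t * b"
      using ineq [of t] by (simp add: power2_eq_square)
    also have "t * b \<le> w \<bullet> w"
      using \<open>0 < w \<bullet> w\<close> b by (simp add: t_def field_simps)
    finally show False
      using \<open>0 < w \<bullet> w\<close> by simp
  qed
  then have "f v = c *\<^sub>R v"
    by (simp add: w_def)
  with vS vn that show thesis by blast
qed

text \<open>Induction on the dimension: split off a unit eigenvector and pass to its orthogonal
  complement in \<open>S\<close>. The statement ranges over invariant subspaces to make this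
  possible.\<close>

lemma self_adjoint_eigenbasis:
  fixes f :: "'a::euclidean_space \<Rightarrow> 'a"
  assumes f: "linear f" and sa: "\<And>x y. f x \<bullet> y = x \<bullet> f y"
    and "subspace S" "\<And>x. x \<in> S \<Longrightarrow> f x \<in> S"
  shows "\<exists>B \<subseteq> S. pairwise orthogonal B \<and> (\<forall>v\<in>B. norm v = 1 \<and> (\<exists>c. f v = c *\<^sub>R v)) \<and> card B = dim S"
  using assms(3,4)
proof (induction "dim S" arbitrary: S rule: less_induct)
  case less
  show ?case
  proof (cases "S = {0}")
    case True
    then show ?thesis by (intro exI [of _ "{}"]) simp
  next
    case False
    obtain v c where v: "v \<in> S" "norm v = 1" "f v = c *\<^sub>R v"
      using self_adjoint_eigenvector [OF f sa less.prems False] by blast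
    let ?T = "{x \<in> S. orthogonal v x}"
    have T: "subspace ?T"
      using less.prems(1) by (auto simp: subspace_def orthogonal_clauses)
    \<comment> \<open>Self-adjointness moves \<open>f\<close> onto the eigenvector \<open>v\<close>,
      which gives a multiple of \<open>v \<bullet> x = 0\<close>.\<close>
    have "f x \<in> ?T" if "x \<in> ?T" for x
      using that less.prems(2) sa [of v x] v(3) by (simp add: orthogonal_def)
    moreover have dim: "dim ?T + 1 = dim S"
    proof -
      have "dim {y \<in> S. \<forall>x\<in>span {v}. orthogonal x y} + dim (span {v}) = dim S"
        using v less.prems(1) by (intro dim_subspace_orthogonal_to_vectors subspace_span span_minimal) auto
      moreover have "{y \<in> S. \<forall>x\<in>span {v}. orthogonal x y} = ?T"
        by (auto simp: span_singleton orthogonal_def)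
      moreover have "dim (span {v}) = 1"
        using v(2) by (subst dim_span, subst dim_eq_card_independent) auto
      ultimately show ?thesis by simp
    qed
    ultimately obtain B where B: "B \<subseteq> ?T" "pairwise orthogonal B"
        "\<forall>v\<in>B. norm v = 1 \<and> (\<exists>c. f v = c *\<^sub>R v)" "card B = dim ?T"
      using less.hyps [of ?T] T by fastforce
    have "v \<notin> B"
      using B(1) v(2) by (auto simp: orthogonal_def)
    have "independent B"
      using B by (intro pairwise_orthogonal_independent) auto
    then have "finite B"
      by (rule independent_imp_finite)
    show ?thesis
    proof (intro exI [of _ "insert v B"] conjI)
      show "pairwise orthogonal (insert v B)"
        using B(1,2) by (auto simp: pairwise_insert orthogonal_commute)
      show "card (insert v B) = dim S"
        using \<open>finite B\<close> \<open>v \<notin> B\<close> B(4) dim by simp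
    qed (use B v in auto)
  qed
qed

lemma symmetric_matrices_diagonalizable:
  "symmetric_matrices \<subseteq> (diagonalizable_matrices :: (real^'n::finite^'n) set)"
proof
  fix A :: "real^'n^'n"
  assume "A \<in> symmetric_matrices"
  then have A: "transpose A = A"
    by (simp add: symmetric_matrices_def)
  have "(A *v x) \<bullet> y = x \<bullet> (A *v y)" for x y
    using A dot_lmul_matrix [of x A y] transpose_matrix_vector [of A x] by simp
  then obtain B where B: "pairwise orthogonal B" "\<And>v. v \<in> B \<Longrightarrow> norm v = 1"
      "\<And>v. v \<in> B \<Longrightarrow> \<exists>c. A *v v = c *\<^sub>R v" "card B = CARD('n)"
    using self_adjoint_eigenbasis [of "(*v) A" UNIV] by (auto simp: matrix_vector_mul_linear)
  have "finite B"
    using B(4) by (intro card_ge_0_finite) simp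
  then obtain h :: "'n \<Rightarrow> real^'n" where h: "bij_betw h UNIV B"
    using B(4) finite_same_card_bij [of "UNIV :: 'n set" B] by auto
  have hB: "h i \<in> B" for i
    using h by (auto simp: bij_betw_def)
  have h_inj: "h i = h j \<longleftrightarrow> i = j" for i j
    using h by (auto simp: bij_betw_def inj_eq)
  have hh: "h i \<bullet> h j = (if i = j then 1 else 0)" for i j
    using B(1,2) hB h_inj by (auto simp: pairwise_def orthogonal_def norm_eq_1)
  obtain l where l: "\<And>i. A *v h i = l i *\<^sub>R h i"
  proof -
    have "\<forall>i. \<exists>c. A *v h i = c *\<^sub>R h i"
      using B(3) hB by blast
    from choice [OF this] that show thesis by blast
  qed
  \<comment> \<open>The orthonormal eigenvectors are the columns of \<open>Q\<close>; then
    \<open>A ** Q = Q ** D\<close> is the eigenvalue equation read column by column.\<close>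
  define Q :: "real^'n^'n" where "Q = (\<chi> i j. h j $ i)"
  define D :: "real^'n^'n" where "D = (\<chi> i j. if i = j then l i else 0)"
  have "transpose Q ** Q = mat 1"
    using hh by (simp add: vec_eq_iff Q_def transpose_def matrix_matrix_mult_def mat_def inner_vec_def)
  then have Q: "invertible Q"
    by (auto simp: invertible_left_inverse)
  have "A ** Q = Q ** D"
  proof -
    have "(A ** Q) $ i $ j = (Q ** D) $ i $ j" for i j
    proof -
      have "(A ** Q) $ i $ j = (A *v h j) $ i"
        by (simp add: Q_def matrix_matrix_mult_def matrix_vector_mult_def)
      also have "\<dots> = l j * h j $ i"
        by (simp add: l)
      also have "\<dots> = (Q ** D) $ i $ j"
        by (simp add: Q_def D_def matrix_matrix_mult_def if_distrib [of "(*) _"] mult.commute cong: if_cong)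
      finally show ?thesis .
    qed
    then show ?thesis by (simp add: vec_eq_iff)
  qed
  then have "A = Q ** D ** matrix_inv Q"
    by (metis Q matrix_inv_inverse(1) matrix_mul_assoc matrix_mul_rid)
  moreover have "diagonal_matrix D"
    by (simp add: diagonal_matrix_def D_def)
  ultimately show "A \<in> diagonalizable_matrices"
    using Q by (auto simp: diagonalizable_matrices_def diagonalizable_def)
qed

section \<open>Affine subspaces\<close>

text \<open>Translates "affine not linear" into a condition on the representation: 0 lies in the
  translate exactly when \<open>- P\<close>, hence \<open>P\<close>, lies in
  \<open>Z\<close>.\<close>

lemma translate_subspace_iff:
  fixes Z :: "'a::real_vector set"
  assumes "subspace Z"
  shows "subspace ((+) P ` Z) \<longleftrightarrow> P \<in> Z"
proof
  assume "subspace ((+) P ` Z)"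
  then obtain z where "z \<in> Z" "0 = P + z"
    using subspace_0 by blast
  then show "P \<in> Z"
    using assms by (metis add_eq_0_iff2 subspace_neg)
next
  assume "P \<in> Z"
  then have "(+) P ` Z = Z"
    using assms by (auto simp: image_iff subspace_add intro!: bexI [of _ "_ - P"] subspace_diff)
  then show "subspace ((+) P ` Z)"
    using assms by simp
qed

text \<open>Adjoining \<open>P\<close> to \<open>Z\<close> raises the dimension by one, and the
  trace form is still nonnegative on the larger span; this gains the strict inequality.\<close>

lemma affine_diagonalizable_dim_less:
  fixes P :: "real^'n::finite^'n"
  assumes Z: "subspace Z" and P: "P \<notin> Z" and diag: "(+) P ` Z \<subseteq> diagonalizable_matrices"
  shows "dim Z < dim (symmetric_matrices :: (real^'n^'n) set)"
proof -
  have diag': "0 \<le> trace ((P + z) ** (P + z))" if "z \<in> Z" for z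
    using diag that by (auto simp: diagonalizable_matrices_def intro!: trace_square_diagonalizable_nonneg)
  have "0 \<le> trace (A ** A)" if A: "A \<in> span (insert P Z)" for A
  proof -
    obtain k where k: "A - k *\<^sub>R P \<in> Z"
      using A Z unfolding span_breakdown_eq by (auto simp: span_eq_iff [THEN iffD2])
    show ?thesis
    \<comment> \<open>For \<open>k = 0\<close> the matrix is a direction of the affine subspace,
      handled by the limit argument; otherwise it is a multiple of one of its points.\<close>
    proof (cases "k = 0")
      case True
      with k Z have "t *\<^sub>R A \<in> Z" for t
        by (simp add: subspace_scale)
      from diag' [OF this] show ?thesis
        by (rule trace_square_direction_nonneg)
    next
      case False
      let ?z = "(1 / k) *\<^sub>R (A - k *\<^sub>R P)"
      have "A = k *\<^sub>R (P + ?z)"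
        using False by (simp add: algebra_simps)
      moreover have "?z \<in> Z"
        using k Z by (simp add: subspace_scale)
      ultimately show ?thesis
        using diag' [of ?z] trace_square_scaleR [of k "P + ?z"] by simp
    qed
  qed
  then have "dim (span (insert P Z)) \<le> dim (symmetric_matrices :: (real^'n^'n) set)"
    by (intro dim_le_symmetric) auto
  then show ?thesis
    using P Z by (simp add: dim_insert span_eq_iff [THEN iffD2])
qed

theorem theorem11:
  fixes n :: nat
  assumes "n = CARD('n::finite)"
  shows
    "((\<forall>Z :: (real^'n^'n) set. subspace Z \<and> Z \<subseteq> diagonalizable_matrices \<longrightarrow>
         real (dim Z) \<le> real n * (real n + 1) / 2) \<and>
      (\<exists>Z :: (real^'n^'n) set. subspace Z \<and> Z \<subseteq> diagonalizable_matrices \<and>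
         real (dim Z) = real n * (real n + 1) / 2)) \<and>
     ((\<forall>(S :: (real^'n^'n) set) d. affine_subspace_of_dim d S \<and> \<not> subspace S \<and>
         S \<subseteq> diagonalizable_matrices \<longrightarrow> real d \<le> real n * (real n + 1) / 2 - 1) \<and>
      (\<exists>(S :: (real^'n^'n) set) d. affine_subspace_of_dim d S \<and> \<not> subspace S \<and>
         S \<subseteq> diagonalizable_matrices \<and> real d = real n * (real n + 1) / 2 - 1))"
proof -
  let ?Sym = "symmetric_matrices :: (real^'n^'n) set"
  have "real (2 * dim ?Sym) = real (n * (n + 1))"
    using dim_symmetric_skew(1) [OF assms] by simp
  then have dimS: "real (dim ?Sym) = real n * (real n + 1) / 2"
    by (simp add: algebra_simps)
  have linear: "dim Z \<le> dim ?Sym" if "subspace Z" "Z \<subseteq> diagonalizable_matrices" for Z :: "(real^'n^'n) set"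
    using that by (intro dim_le_symmetric trace_square_diagonalizable_nonneg)
      (auto simp: diagonalizable_matrices_def)
  have affine: "d < dim ?Sym"
    if "affine_subspace_of_dim d S" "\<not> subspace S" "S \<subseteq> diagonalizable_matrices"
    for S :: "(real^'n^'n) set" and d
  proof -
    obtain P Z where "subspace Z" "S = (+) P ` Z" "dim Z = d"
      using \<open>affine_subspace_of_dim d S\<close> unfolding affine_subspace_of_dim_def by blast
    with that(2,3) show ?thesis
      using affine_diagonalizable_dim_less [of Z P] translate_subspace_iff [of Z P] by simp
  qed
  \<comment> \<open>Ensures that the natural-number subtraction \<open>dim ?Sym - 1\<close> below is
    not truncated.\<close>
  have "0 < dim ?Sym"
    using dim_symmetric_skew(1) [OF assms] assms by (auto intro: gr0I)
  \<comment> \<open>A hyperplane of \<open>?Sym\<close>; its translate by a symmetric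
    \<open>P\<close> outside it stays symmetric and misses 0, which gives the extremal affine
    example.\<close>
  obtain Z where Z: "subspace Z" "Z \<subseteq> ?Sym" "dim Z = dim ?Sym - 1"
    using choose_subspace_of_subspace [of "dim ?Sym - 1" ?Sym] subspace_symmetric_matrices
    by (metis diff_le_self span_eq_iff)
  then have "Z \<noteq> ?Sym"
    using \<open>0 < dim ?Sym\<close> by auto
  with Z(2) obtain P where P: "P \<in> ?Sym" "P \<notin> Z"
    by blast
  let ?S = "(+) P ` Z"
  have "?S \<subseteq> ?Sym"
    using Z(2) P(1) by (auto intro: subspace_add subspace_symmetric_matrices)
  then have "affine_subspace_of_dim (dim ?Sym - 1) ?S \<and> \<not> subspace ?S \<and> ?S \<subseteq> diagonalizable_matrices"
    using Z P symmetric_matrices_diagonalizable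
    by (auto simp: affine_subspace_of_dim_def translate_subspace_iff)
  moreover have "real (dim ?Sym - 1) = real n * (real n + 1) / 2 - 1"
    using \<open>0 < dim ?Sym\<close> dimS by (simp add: of_nat_diff)
  moreover have "real d \<le> real n * (real n + 1) / 2 - 1" if "d < dim ?Sym" for d
    using that dimS by linarith
  moreover have "real (dim Z) \<le> real n * (real n + 1) / 2"
    if "subspace Z" "Z \<subseteq> diagonalizable_matrices" for Z :: "(real^'n^'n) set"
    using linear [OF that] dimS by linarith
  ultimately show ?thesis
    using affine dimS subspace_symmetric_matrices symmetric_matrices_diagonalizable by blast
qed

end
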